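(* Let $H(x)=\sum_{n\ge1}a_nx^n$, where $a_n$ is the number of $2$-row-restricted slicings of size $n$. Then $$H(x)=\frac{x\,(H(x)+1)}{1-x\,(H(x)+1)^2}.$$
   Context: Parallelogram polyominoes are edge-connected sets of unit cells bounded by two lattice paths with steps $(0,1)$ and $(1,0)$ meeting only at their endpoints. The size is $k+\ell-1$ for a $k\times\ell$ bounding rectangle. A Baxter slicing of size $n$ is such a polyomino of size $n$ divided into $n$ blocks, defined recursively: - for $n=1$, the single cell is the single block; - for $n\ge2$, one block is the topmost row (horizontal block) or the rightmost column (vertical block), and the other blocks form a Baxter slicing of the polyomino obtained by deleting it. A $2$-row-restricted slicing is a Baxter slicing all of whose horizontal blocks have width at most $2$. *)

theory Defs
  imports "HOL-Computational_Algebra.Formal_Power_Series"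
begin

text \<open>
  The pair \<open>(i, j)\<close>, read as a cell, is the unit square with lower left corner \<open>(i, j)\<close>.
  Polyominoes are considered up to translation: the two boundary paths start at the origin.
\<close>

type_synonym cell = "nat \<times> nat"

definition edge_adjacent :: "(cell \<times> cell) set" where
  "edge_adjacent = {((i, j), (i', j')).
     (j = j' \<and> (i' = Suc i \<or> i = Suc i')) \<or> (i = i' \<and> (j' = Suc j \<or> j = Suc j'))}"

definition edge_connected :: "cell set \<Rightarrow> bool" where
  "edge_connected P \<longleftrightarrow> (\<forall>c\<in>P. \<forall>d\<in>P. (c, d) \<in> (edge_adjacent \<inter> P \<times> P)\<^sup>*)"

datatype step = North | East

definition path_point :: "step list \<Rightarrow> nat \<Rightarrow> nat \<times> nat" where
  "path_point p m = (count_list (take m p) East, count_list (take m p) North)"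

definition path_end :: "step list \<Rightarrow> nat \<times> nat" where
  "path_end p = path_point p (length p)"

definition path_points :: "step list \<Rightarrow> (nat \<times> nat) set" where
  "path_points p = path_point p ` {..length p}"

text \<open>The path traverses the horizontal edge from \<open>(i, a)\<close> to \<open>(i + 1, a)\<close>.\<close>

definition has_east_edge :: "step list \<Rightarrow> nat \<Rightarrow> nat \<Rightarrow> bool" where
  "has_east_edge p i a \<longleftrightarrow> (\<exists>m<length p. p ! m = East \<and> path_point p m = (i, a))"

definition cells_between :: "step list \<Rightarrow> step list \<Rightarrow> cell set" where
  "cells_between lo up =
     {(i, j). \<exists>a b. has_east_edge lo i a \<and> has_east_edge up i b \<and> a \<le> j \<and> j < b}"

text \<open>
  Two lattice paths can only meet in lattice points or along common edges, so comparing their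
  lattice points is enough. The condition \<open>P \<noteq> {}\<close> rules out a single common edge, which
  has no lattice points besides its endpoints, and an exchange of the lower and the upper path.
\<close>

definition parallelogram_polyomino :: "cell set \<Rightarrow> bool" where
  "parallelogram_polyomino P \<longleftrightarrow>
     P \<noteq> {} \<and> edge_connected P \<and>
     (\<exists>lo up. path_end lo = path_end up \<and>
              path_points lo \<inter> path_points up = {(0, 0), path_end up} \<and>
              P = cells_between lo up)"

definition box_width :: "cell set \<Rightarrow> nat" where
  "box_width P = Max (fst ` P) - Min (fst ` P) + 1"

definition box_height :: "cell set \<Rightarrow> nat" where
  "box_height P = Max (snd ` P) - Min (snd ` P) + 1"

definition poly_size :: "cell set \<Rightarrow> nat" where
  "poly_size P = box_width P + box_height P - 1"

definition top_row :: "cell set \<Rightarrow> cell set" where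
  "top_row P = {c \<in> P. snd c = Max (snd ` P)}"

definition right_column :: "cell set \<Rightarrow> cell set" where
  "right_column P = {c \<in> P. fst c = Max (fst ` P)}"

text \<open>
  \<open>baxter_slicing n P B Hs\<close>: the blocks in \<open>B\<close> form a Baxter slicing of size \<open>n\<close> of the
  polyomino \<open>P\<close>, and \<open>Hs \<subseteq> B\<close> is the set of its horizontal blocks. The size \<open>n\<close> is required
  to drop by exactly one at each deletion, so a row or column whose removal also shrinks the
  other side of the bounding rectangle is not a block.
\<close>

inductive baxter_slicing :: "nat \<Rightarrow> cell set \<Rightarrow> cell set set \<Rightarrow> cell set set \<Rightarrow> bool" where
  single: "parallelogram_polyomino P \<Longrightarrow> poly_size P = 1 \<Longrightarrow> baxter_slicing 1 P {P} {}"
| horizontal: "parallelogram_polyomino P \<Longrightarrow> poly_size P = Suc n \<Longrightarrow>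
    baxter_slicing n (P - top_row P) B Hs \<Longrightarrow>
    baxter_slicing (Suc n) P (insert (top_row P) B) (insert (top_row P) Hs)"
| vertical: "parallelogram_polyomino P \<Longrightarrow> poly_size P = Suc n \<Longrightarrow>
    baxter_slicing n (P - right_column P) B Hs \<Longrightarrow>
    baxter_slicing (Suc n) P (insert (right_column P) B) Hs"

definition row_restricted_slicings :: "nat \<Rightarrow> nat \<Rightarrow> (cell set \<times> cell set set) set" where
  "row_restricted_slicings m n =
     {(P, B). \<exists>Hs. baxter_slicing n P B Hs \<and> (\<forall>b\<in>Hs. box_width b \<le> m)}"

definition slicing_gf :: "rat fps" where
  "slicing_gf = Abs_fps (\<lambda>n. if n \<ge> 1 then of_nat (card (row_restricted_slicings 2 n)) else 0)"

end

theory Submission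
  imports Defs
begin

text \<open>
  A slicing whose top row has width \<open>h\<close> and whose right column has height \<open>k\<close> extends to a
  slicing of the next size by a new top row of any width \<open>w \<le> min 2 h\<close>, with label
  \<open>(w, k + 1)\<close>, or by a new right column of any height \<open>j \<le> k\<close>, with label \<open>(h + 1, j)\<close>; the
  last block can be recovered. So slicings are the nodes of a generating tree with root
  \<open>(1, 1)\<close>. Let \<open>H\<close> solve \<open>H = x (1 + H) (1 + H + H\<^sup>2)\<close>, which is the claimed equation, and put
  \<open>r = 1 + H + H\<^sup>2\<close>. Then \<open>H r\<^bsup>k-1\<^esup>\<close> for \<open>h = 1\<close> and \<open>H (1 + H) r\<^bsup>k-1\<^esup>\<close> for \<open>h \<ge> 2\<close>
  satisfy the recurrence of the generating functions of the subtrees below \<open>(h, k)\<close>, because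
  \<open>r - 1 = H (1 + H)\<close> makes the sum over the new columns telescope to \<open>r\<^bsup>k\<^esup> - 1\<close>. At the root
  this gives \<open>H\<close>.
\<close>

section \<open>Lattice paths as height functions\<close>

text \<open>A path is encoded by the heights \<open>f i\<close> of its east steps over the columns
  \<open>i < k\<close>; values of \<open>f\<close> from \<open>k\<close> on are free. The last
  conjunct describes the vertical run at each abscissa: it starts at the height of the preceding
  east step and stops at that of the next one, with \<open>0\<close> and \<open>l\<close> in these
  roles at the two ends.\<close>

definition path_heights :: "step list \<Rightarrow> (nat \<Rightarrow> nat) \<Rightarrow> nat \<Rightarrow> nat \<Rightarrow> bool" where
  "path_heights p f k l \<longleftrightarrow>
     path_end p = (k, l) \<and>
     (\<forall>i<k. f i \<le> l) \<and> (\<forall>i. Suc i < k \<longrightarrow> f i \<le> f (Suc i)) \<and>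
     (\<forall>i a. has_east_edge p i a \<longleftrightarrow> i < k \<and> a = f i) \<and>
     (\<forall>i j. (i, j) \<in> path_points p \<longleftrightarrow>
        i \<le> k \<and> j \<le> l \<and> (0 < i \<longrightarrow> f (i - 1) \<le> j) \<and> (i < k \<longrightarrow> j \<le> f i))"

lemma path_heightsD:
  assumes "path_heights p f k l"
  shows path_heights_end: "path_end p = (k, l)"
    and path_heights_le: "i < k \<Longrightarrow> f i \<le> l"
    and path_heights_mono: "Suc i < k \<Longrightarrow> f i \<le> f (Suc i)"
    and path_heights_edge: "has_east_edge p i a \<longleftrightarrow> i < k \<and> a = f i"
    and path_heights_point: "(i, j) \<in> path_points p \<longleftrightarrow>
        i \<le> k \<and> j \<le> l \<and> (0 < i \<longrightarrow> f (i - 1) \<le> j) \<and> (i < k \<longrightarrow> j \<le> f i)"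
  using assms unfolding path_heights_def by simp_all

lemma path_end_eq: "path_end p = (count_list p East, count_list p North)"
  by (simp add: path_end_def path_point_def)

lemma path_points_append:
  "path_points (p @ [s]) = insert (path_end (p @ [s])) (path_points p)"
proof -
  have "path_point (p @ [s]) ` {..length p} = path_point p ` {..length p}"
    by (intro image_cong) (auto simp: path_point_def)
  then show ?thesis
    by (simp add: path_points_def path_end_def atMost_Suc)
qed

lemma has_east_edge_append:
  "has_east_edge (p @ [s]) i a \<longleftrightarrow> has_east_edge p i a \<or> s = East \<and> path_end p = (i, a)"
proof -
  have "(p @ [s]) ! m = East \<and> path_point (p @ [s]) m = (i, a) \<longleftrightarrow>
      p ! m = East \<and> path_point p m = (i, a)" if "m < length p" for m
    using that by (simp add: nth_append path_point_def)
  moreover have "has_east_edge (p @ [s]) i a \<longleftrightarrow>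
      (\<exists>m<length p. (p @ [s]) ! m = East \<and> path_point (p @ [s]) m = (i, a)) \<or>
      s = East \<and> path_end p = (i, a)"
    unfolding has_east_edge_def path_end_def length_append_singleton Ex_less_Suc
    by (simp add: path_point_def disj_commute)
  ultimately show ?thesis
    unfolding has_east_edge_def by blast
qed

lemma path_heights_Nil: "path_heights [] f 0 0"
  by (auto simp: path_heights_def path_end_eq has_east_edge_def path_points_def path_point_def)

lemma path_heights_North:
  assumes "path_heights p f k l"
  shows "path_heights (p @ [North]) f k (Suc l)"
proof -
  have e: "path_end (p @ [North]) = (k, Suc l)"
    using path_heights_end[OF assms] by (auto simp: path_end_eq)
  note b = path_heights_le[OF assms] and mono = path_heights_mono[OF assms]
    and edge = path_heights_edge[OF assms] and pt = path_heights_point[OF assms]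
  have m: "f (k - 1) \<le> l" if "0 < k"
    using b[of "k - 1"] that by simp
  have "(i, j) \<in> path_points (p @ [North]) \<longleftrightarrow>
        i \<le> k \<and> j \<le> Suc l \<and> (0 < i \<longrightarrow> f (i - 1) \<le> j) \<and> (i < k \<longrightarrow> j \<le> f i)" for i j
  proof (cases "j = Suc l")
    case True
    \<comment> \<open>Only the abscissa \<open>k\<close> can gain the height \<open>Suc l\<close>;
      earlier ones are capped by \<open>f i \<le> l\<close>.\<close>
    have "\<not> Suc l \<le> f i" if "i < k"
      using b[OF that] by simp
    then show ?thesis
      unfolding path_points_append insert_iff e pt using m True by fastforce
  qed (simp add: path_points_append e pt le_Suc_eq)
  moreover have "has_east_edge (p @ [North]) i a \<longleftrightarrow> i < k \<and> a = f i" for i a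
    by (simp add: has_east_edge_append edge)
  ultimately show ?thesis
    unfolding path_heights_def using e b mono le_SucI by blast
qed

lemma path_heights_East:
  assumes "path_heights p f k l"
  shows "path_heights (p @ [East]) (f(k := l)) (Suc k) l"
proof -
  have e: "path_end (p @ [East]) = (Suc k, l)" "path_end p = (k, l)"
    using path_heights_end[OF assms] by (auto simp: path_end_eq)
  note b = path_heights_le[OF assms] and mono = path_heights_mono[OF assms]
    and edge = path_heights_edge[OF assms] and pt = path_heights_point[OF assms]
  have "(i, j) \<in> path_points (p @ [East]) \<longleftrightarrow>
        i \<le> Suc k \<and> j \<le> l \<and> (0 < i \<longrightarrow> (f(k := l)) (i - 1) \<le> j) \<and>
        (i < Suc k \<longrightarrow> j \<le> (f(k := l)) i)" for i j
  proof (cases "i \<le> k")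
    case True
    then show ?thesis
      by (cases "i = k") (auto simp: path_points_append e pt)
  next
    case False
    then show ?thesis
      by (cases "i = Suc k") (auto simp: path_points_append e pt)
  qed
  moreover have "has_east_edge (p @ [East]) i a \<longleftrightarrow> i < Suc k \<and> a = (f(k := l)) i" for i a
    using e by (auto simp: has_east_edge_append edge less_Suc_eq)
  moreover have "(f(k := l)) i \<le> l" if "i < Suc k" for i
    using b[of i] that by simp
  moreover have "(f(k := l)) i \<le> (f(k := l)) (Suc i)" if "Suc i < Suc k" for i
    using b[of i] mono[of i] that by simp
  ultimately show ?thesis
    unfolding path_heights_def using e(1) by blast
qed

lemma ex_heights_of_path: "\<exists>f. path_heights p f (fst (path_end p)) (snd (path_end p))"
proof (induction p rule: rev_induct)
  case Nil
  show ?case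
    using path_heights_Nil by (auto simp: path_end_eq)
next
  case (snoc s p)
  then obtain f where f: "path_heights p f (fst (path_end p)) (snd (path_end p))"
    by blast
  show ?case
    using path_heights_North[OF f] path_heights_East[OF f]
    by (cases s) (auto simp: path_end_eq)
qed

text \<open>Induction on the number of east steps: reach the start of the last one at height
  \<open>f k\<close>, go east, then climb to \<open>l\<close>.\<close>

lemma ex_path_of_heights:
  assumes "\<And>i. i < k \<Longrightarrow> f i \<le> l" and "\<And>i. Suc i < k \<Longrightarrow> f i \<le> f (Suc i)"
  shows "\<exists>p. path_heights p f k l"
proof -
  have climb: "\<exists>p. path_heights p g k' (a + d)" if "path_heights q g k' a" for q g k' a d
  proof (induction d)
    case (Suc d)
    then show ?case
      using path_heights_North by (metis add_Suc_right)
  qed (use that in auto)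
  show ?thesis
    using assms
  proof (induction k arbitrary: l)
    case 0
    then show ?case
      using climb[OF path_heights_Nil, of f l] by simp
  next
    case (Suc k)
    have "\<exists>p. path_heights p f k (f k)"
    proof (rule Suc.IH)
      fix i
      assume "i < k"
      then show "f i \<le> f k"
        using Suc.prems(2) by (induction k) (auto simp: less_Suc_eq intro: order_trans)
    qed (use Suc.prems in auto)
    then obtain p where "path_heights p f k (f k)"
      by blast
    \<comment> \<open>The shorter path ends at height \<open>f k\<close>, so the update made by the
      east step leaves \<open>f\<close> unchanged.\<close>
    then have "path_heights (p @ [East]) (f(k := f k)) (Suc k) (f k)"
      by (rule path_heights_East)
    then show ?case
      using climb[of "p @ [East]" f "Suc k" "f k" "l - f k"] Suc.prems(1)[of k] by simp
  qed
qed

section \<open>Parallelogram polyominoes by columns\<close>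

text \<open>The columns are numbered from \<open>0\<close> to \<open>k\<close>, so the width is \<open>k + 1\<close>; the height is \<open>g k\<close>.\<close>

definition columns :: "nat \<Rightarrow> (nat \<Rightarrow> nat) \<Rightarrow> (nat \<Rightarrow> nat) \<Rightarrow> cell set" where
  "columns k f g = {(i, j). i \<le> k \<and> f i \<le> j \<and> j < g i}"

text \<open>Neighbouring columns share an edge because \<open>f (Suc i) < g i\<close>. With
  \<open>f\<close> monotone this already makes all columns before \<open>k\<close> nonempty;
  \<open>f k < g k\<close> does it for the last one.\<close>

definition staircase :: "nat \<Rightarrow> (nat \<Rightarrow> nat) \<Rightarrow> (nat \<Rightarrow> nat) \<Rightarrow> bool" where
  "staircase k f g \<longleftrightarrow> f 0 = 0 \<and> f k < g k \<and>
     (\<forall>i<k. f i \<le> f (Suc i) \<and> g i \<le> g (Suc i) \<and> f (Suc i) < g i)"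

lemma in_columns [simp]: "(i, j) \<in> columns k f g \<longleftrightarrow> i \<le> k \<and> f i \<le> j \<and> j < g i"
  by (simp add: columns_def)

lemma staircase_mono:
  assumes "staircase k f g" and "i \<le> i'" and "i' \<le> k"
  shows "f i \<le> f i'" and "g i \<le> g i'"
  using assms(2,3)
proof (induction rule: dec_induct)
  case (step n)
  {
    case 1
    then show ?case
      using step assms(1) by (auto simp: staircase_def intro: order_trans)
  next
    case 2
    then show ?case
      using step assms(1) by (auto simp: staircase_def intro: order_trans)
  }
qed auto

lemma staircase_less:
  assumes "staircase k f g" and "i \<le> k"
  shows "f i < g i"
proof (cases "i = k")
  case False
  then have "f i \<le> f (Suc i)" and "f (Suc i) < g i"
    using assms by (auto simp: staircase_def)
  then show ?thesis
    by (rule le_less_trans)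
qed (use assms in \<open>auto simp: staircase_def\<close>)

text \<open>Every cell is linked to the origin: go down within the column, and from its lowest cell
  step left, which stays inside because \<open>f i \<le> f (Suc i) < g i\<close>. The sum of the
  coordinates decreases.\<close>

lemma edge_connected_columns:
  assumes "staircase k f g"
  shows "edge_connected (columns k f g)"
proof -
  let ?P = "columns k f g"
  let ?R = "edge_adjacent \<inter> ?P \<times> ?P"
  have sym: "sym ?R"
    by (auto simp: sym_def edge_adjacent_def)
  have origin: "((i, j), (0, 0)) \<in> ?R\<^sup>*" if "(i, j) \<in> ?P" for i j
    using that
  proof (induction "i + j" arbitrary: i j rule: less_induct)
    case less
    consider "i = 0" "j = 0" | j' where "j = Suc j'" "f i \<le> j'" | i' where "i = Suc i'" "j = f i"
      using less.prems assms
      by (cases i; cases j) (auto simp: staircase_def le_less_Suc_eq le_Suc_eq)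
    then show ?case
    proof cases
      case (2 j')
      then have "(i, j') \<in> ?P"
        using less.prems by auto
      moreover have "((i, j), (i, j')) \<in> ?R"
        using 2 less.prems calculation by (auto simp: edge_adjacent_def)
      ultimately show ?thesis
        using less.hyps[of i j'] 2 by (auto intro: converse_rtrancl_into_rtrancl)
    next
      case (3 i')
      then have "(i', j) \<in> ?P"
        using less.prems assms by (auto simp: staircase_def)
      moreover have "((i, j), (i', j)) \<in> ?R"
        using 3 less.prems calculation by (auto simp: edge_adjacent_def)
      ultimately show ?thesis
        using less.hyps[of i' j] 3 by (auto intro: converse_rtrancl_into_rtrancl)
    qed simp
  qed
  show ?thesis
    unfolding edge_connected_def
    using origin sym_rtrancl[OF sym] by (metis prod.collapse rtrancl_trans symD)
qed

lemma cells_between_heights: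
  assumes "path_heights p f (Suc k) l" and "path_heights q g (Suc k) l"
  shows "cells_between p q = columns k f g"
  unfolding cells_between_def columns_def
    path_heights_edge[OF assms(1)] path_heights_edge[OF assms(2)]
  by auto

lemma parallelogram_polyomino_columns:
  assumes "staircase k f g"
  shows "parallelogram_polyomino (columns k f g)"
proof -
  have "\<exists>p. path_heights p f (Suc k) (g k)"
    using assms staircase_mono(1)[OF assms, of _ k]
    by (intro ex_path_of_heights)
      (auto simp: staircase_def less_Suc_eq_le intro: le_less_trans less_imp_le)
  then obtain p where p: "path_heights p f (Suc k) (g k)"
    by blast
  have "\<exists>q. path_heights q g (Suc k) (g k)"
    using assms staircase_mono(2)[OF assms, of _ k]
    by (intro ex_path_of_heights) (auto simp: staircase_def less_Suc_eq_le)
  then obtain q where q: "path_heights q g (Suc k) (g k)"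
    by blast
  note pt = path_heights_point[OF p] path_heights_point[OF q]
  have ends: "f 0 = 0" "f k < g k"
    using assms by (auto simp: staircase_def)
  have "(i, j) \<in> path_points p \<inter> path_points q \<longleftrightarrow> (i, j) \<in> {(0, 0), (Suc k, g k)}" for i j
  proof -
    consider "i = 0" | i' where "i = Suc i'" "i' < k" | "i = Suc k" | "i > Suc k"
      by (cases i) (auto intro: linorder_cases[of "i - 1" k])
    then show ?thesis
    proof cases
      case (2 i')
      \<comment> \<open>At abscissa \<open>Suc i'\<close> the lower path stops climbing at
        \<open>f (Suc i')\<close> and the upper path arrives at \<open>g i'\<close>, so they do not
        meet there.\<close>
      then have "f (Suc i') < g i'"
        using assms by (simp add: staircase_def)
      then show ?thesis
        using 2 by (simp add: pt)
    next
      case 3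
      then show ?thesis
        using ends by (auto simp: pt)
    qed (use ends in \<open>auto simp: pt\<close>)
  qed
  then have "path_points p \<inter> path_points q = {(0, 0), path_end q}"
    unfolding path_heights_end[OF q] by (intro set_eqI) (simp only: split_paired_all)
  moreover have "(0, 0) \<in> columns k f g"
    using assms staircase_less[OF assms, of 0] by (auto simp: staircase_def)
  ultimately show ?thesis
    unfolding parallelogram_polyomino_def
    using edge_connected_columns[OF assms] cells_between_heights[OF p q]
      path_heights_end[OF p] path_heights_end[OF q] by (metis empty_iff)
qed

text \<open>Nonemptiness supplies one column \<open>i\<^sub>0\<close> in which \<open>f\<close> is
  below \<open>g\<close>. As the paths do not meet between their endpoints, this order persists to
  the right and to the left.\<close>

lemma staircase_of_polyomino:
  assumes "parallelogram_polyomino P"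
  obtains k f g where "staircase k f g" and "P = columns k f g"
proof -
  obtain p q where ends: "path_end p = path_end q"
    and meet: "path_points p \<inter> path_points q = {(0, 0), path_end q}"
    and P: "P = cells_between p q" and "P \<noteq> {}"
    using assms by (auto simp: parallelogram_polyomino_def)
  obtain w l where wl: "path_end q = (w, l)"
    by fastforce
  obtain f g where f: "path_heights p f w l" and g: "path_heights q g w l"
    using ex_heights_of_path[of p] ex_heights_of_path[of q] ends wl by auto
  obtain i\<^sub>0 where i0: "i\<^sub>0 < w" "f i\<^sub>0 < g i\<^sub>0"
    using \<open>P \<noteq> {}\<close> unfolding P cells_between_def path_heights_edge[OF f] path_heights_edge[OF g]
    by fastforce
  note pt = path_heights_point[OF f] path_heights_point[OF g]
  define k where "k = w - 1"
  have w: "w = Suc k"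
    using i0 by (simp add: k_def)
  have in_meet: "(i, j) \<in> {(0, 0), (w, l)}"
    if "(i, j) \<in> path_points p" "(i, j) \<in> path_points q" for i j
    using IntI[OF that] unfolding meet wl .
  have mono: "f i \<le> f (Suc i)" "g i \<le> g (Suc i)" if "i < k" for i
    using path_heights_mono[OF f] path_heights_mono[OF g] that by (auto simp: w)
  have bound: "f i \<le> l" "g i \<le> l" if "i \<le> k" for i
    using path_heights_le[OF f] path_heights_le[OF g] that by (auto simp: w)
  \<comment> \<open>Otherwise the paths would meet in the abscissa \<open>i + 1\<close> at the height given by the maximum.\<close>
  have apart: "min (f (Suc i)) (g (Suc i)) < max (f i) (g i)" if "i < k" for i
  proof (rule ccontr)
    assume "\<not> ?thesis"
    then have "(Suc i, max (f i) (g i)) \<in> path_points p"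
      and "(Suc i, max (f i) (g i)) \<in> path_points q"
      using that bound[of i] by (auto simp: pt w)
    then show False
      using in_meet[of "Suc i" "max (f i) (g i)"] that by (auto simp: w)
  qed
  have up: "f i < g i" if "i\<^sub>0 \<le> i" "i \<le> k" for i
    using that
  proof (induction rule: dec_induct)
    case (step n)
    then show ?case
      using mono[of n] apart[of n] by (auto simp: min_def max_def split: if_splits)
  qed (use i0 in auto)
  have less: "f i < g i" if "i \<le> k" for i
  proof (cases "i\<^sub>0 \<le> i")
    case False
    then have "i \<le> i\<^sub>0" by simp
    then show ?thesis
    proof (induction rule: inc_induct)
      case (step n)
      then show ?case
        using mono[of n] apart[of n] i0 w by (auto simp: min_def max_def split: if_splits)
    qed (use i0 in auto)
  qed (use that up in auto)
  \<comment> \<open>The start of the first east step of the lower path also lies on the upper path,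
    since \<open>f 0 < g 0\<close>; at abscissa \<open>0\<close> the paths share only the
    origin.\<close>
  have "f 0 = 0"
  proof -
    have "(0, f 0) \<in> path_points p" "(0, f 0) \<in> path_points q"
      using less[of 0] bound[of 0] by (auto simp: pt w)
    then show ?thesis
      using in_meet[of 0 "f 0"] by (auto simp: w)
  qed
  moreover have "f (Suc i) < g i" if "i < k" for i
    using apart[OF that] less[of i] less[of "Suc i"] that by (auto simp: min_def max_def)
  ultimately have "staircase k f g"
    using less mono by (auto simp: staircase_def)
  moreover have "P = columns k f g"
    using cells_between_heights f g P w by simp
  ultimately show thesis
    by (rule that)
qed

lemma staircase_box:
  assumes "staircase k f g"
  shows Max_fst_columns: "Max (fst ` columns k f g) = k"
    and Max_snd_columns: "Max (snd ` columns k f g) = g k - 1"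
    and box_width_columns: "box_width (columns k f g) = Suc k"
    and box_height_columns: "box_height (columns k f g) = g k"
proof -
  let ?P = "columns k f g"
  have sub: "?P \<subseteq> {..k} \<times> {..g k - 1}"
    using staircase_mono(2)[OF assms, of _ k] by (force simp: columns_def)
  then have fin: "finite ?P"
    by (rule finite_subset) simp
  have in0: "(0, 0) \<in> ?P" and ink: "(k, g k - 1) \<in> ?P"
    using assms staircase_less[OF assms, of 0] by (auto simp: staircase_def)
  show M1: "Max (fst ` ?P) = k"
    using fin sub ink by (intro Max_eqI) (auto simp: image_iff intro!: bexI[of _ "(k, g k - 1)"])
  show M2: "Max (snd ` ?P) = g k - 1"
    using fin sub ink by (intro Max_eqI) (auto simp: image_iff intro!: bexI[of _ "(k, g k - 1)"])
  have m1: "Min (fst ` ?P) = 0"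
    using fin in0 by (intro Min_eqI) (auto simp: image_iff intro!: bexI[of _ "(0, 0)"])
  have m2: "Min (snd ` ?P) = 0"
    using fin in0 by (intro Min_eqI) (auto simp: image_iff intro!: bexI[of _ "(0, 0)"])
  show "box_width ?P = Suc k" "box_height ?P = g k"
    using assms by (auto simp: box_width_def box_height_def M1 M2 m1 m2 staircase_def)
qed

lemma right_column_columns:
  assumes "staircase k f g"
  shows "right_column (columns k f g) = {k} \<times> {f k..<g k}"
  by (auto simp: right_column_def Max_fst_columns[OF assms])

text \<open>Monotonicity of \<open>g\<close> makes the columns of maximal height a final segment,
  whose first index is \<open>s\<close>. Each of them contains its cell at that height since
  \<open>f i \<le> f k < g k\<close>.\<close>

lemma top_row_columns:
  assumes "staircase k f g"
  obtains s where "s \<le> k" and "\<And>i. i \<le> k \<Longrightarrow> g i = g k \<longleftrightarrow> s \<le> i"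
    and "top_row (columns k f g) = {s..k} \<times> {g k - 1}"
proof -
  define s where "s = (LEAST i. g i = g k)"
  have s: "g s = g k" "s \<le> k"
    unfolding s_def by (auto intro: LeastI Least_le)
  have eq: "g i = g k \<longleftrightarrow> s \<le> i" if "i \<le> k" for i
    using staircase_mono(2)[OF assms, of s i] staircase_mono(2)[OF assms, of i k] s that
    by (auto simp: s_def intro: Least_le)
  have "(i, j) \<in> top_row (columns k f g) \<longleftrightarrow> (i, j) \<in> {s..k} \<times> {g k - 1}" for i j
  proof (cases "i \<le> k")
    case True
    then have "f i \<le> g k - 1" "g i \<le> g k" "0 < g k"
      using staircase_mono[OF assms, of i k] staircase_less[OF assms, of k] by auto
    then show ?thesis
      using eq[OF True] by (auto simp: top_row_def Max_snd_columns[OF assms])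
  qed (auto simp: top_row_def)
  then have "top_row (columns k f g) = {s..k} \<times> {g k - 1}"
    by (intro set_eqI) (simp only: split_paired_all)
  then show thesis
    using s eq by (intro that)
qed

lemma poly_size_columns:
  assumes "staircase k f g"
  shows "poly_size (columns k f g) = k + g k"
  by (simp add: poly_size_def box_width_columns[OF assms] box_height_columns[OF assms])

section \<open>Adding and removing blocks\<close>

text \<open>Cell coordinates start at \<open>0\<close>, so \<open>box_height P\<close> is the first
  free ordinate; the row is flush right. \<open>new_column\<close> is the mirrored construction,
  flush with the top.\<close>

definition new_row :: "cell set \<Rightarrow> nat \<Rightarrow> cell set" where
  "new_row P w = {box_width P - w..<box_width P} \<times> {box_height P}"

definition new_column :: "cell set \<Rightarrow> nat \<Rightarrow> cell set" where
  "new_column P w = {box_width P} \<times> {box_height P - w..<box_height P}"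

lemma box_width_atLeastLessThan:
  assumes "w \<le> l" and "0 < w"
  shows "box_width ({l - w..<l} \<times> {j}) = w"
proof -
  have "Max {l - w..<l} = l - 1" and "Min {l - w..<l} = l - w"
    using assms by (auto intro!: Max_eqI Min_eqI)
  then show ?thesis
    using assms by (simp add: box_width_def fst_image_times)
qed

text \<open>The bound on \<open>w\<close> lets the new row rest on the old top row, so the union
  arises by raising \<open>g\<close> by one on the last \<open>w\<close> columns, those from
  \<open>t\<close> on.\<close>

lemma add_row:
  assumes "parallelogram_polyomino P" and "1 \<le> w" and "w \<le> card (top_row P)"
  defines "R \<equiv> new_row P w"
  shows "parallelogram_polyomino (P \<union> R)"
    and "poly_size (P \<union> R) = Suc (poly_size P)"
    and "top_row (P \<union> R) = R"
    and "P \<inter> R = {}" and "R \<noteq> {}"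
    and "\<not> right_column (P \<union> R) \<subseteq> P" and "\<not> right_column (P \<union> R) \<subseteq> R"
    and "card R = w" and "box_width R = w"
    and "card (right_column (P \<union> R)) = Suc (card (right_column P))"
proof -
  obtain k f g where st: "staircase k f g" and P: "P = columns k f g"
    using staircase_of_polyomino assms(1) by blast
  obtain s where s: "s \<le> k" "\<And>i. i \<le> k \<Longrightarrow> g i = g k \<longleftrightarrow> s \<le> i"
    and top: "top_row P = {s..k} \<times> {g k - 1}"
    using top_row_columns[OF st] P by metis
  define t where "t = Suc k - w"
  have t: "s \<le> t" "t \<le> k" "w = Suc k - t"
    using assms(2,3) s(1) by (auto simp: top card_cartesian_product t_def)
  have R: "R = {t..k} \<times> {g k}"
    by (auto simp: R_def new_row_def P box_width_columns[OF st] box_height_columns[OF st] t_def)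
  define g' where "g' i = (if t \<le> i then Suc (g i) else g i)" for i
  have st': "staircase k f g'"
    using st t(2) by (auto simp: staircase_def g'_def intro: le_SucI less_SucI)
  have PR: "P \<union> R = columns k f g'"
  proof (intro set_eqI, simp only: split_paired_all)
    fix i j
    show "(i, j) \<in> P \<union> R \<longleftrightarrow> (i, j) \<in> columns k f g'"
      using s(2)[of i] t staircase_less[OF st, of i] by (auto simp: P R g'_def)
  qed
  show "parallelogram_polyomino (P \<union> R)"
    unfolding PR using st' by (rule parallelogram_polyomino_columns)
  show "poly_size (P \<union> R) = Suc (poly_size P)"
    unfolding PR unfolding P poly_size_columns[OF st] poly_size_columns[OF st']
    using t by (simp add: g'_def)
  obtain s' where s': "s' \<le> k" "\<And>i. i \<le> k \<Longrightarrow> g' i = g' k \<longleftrightarrow> s' \<le> i"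
    and top': "top_row (columns k f g') = {s'..k} \<times> {g' k - 1}"
    using top_row_columns[OF st'] by metis
  \<comment> \<open>Columns before \<open>t\<close> keep a height of at most \<open>g k\<close>,
    below the new maximum \<open>Suc (g k)\<close>.\<close>
  have iff: "s' \<le> i \<longleftrightarrow> t \<le> i" if "i \<le> k" for i
    using s'(2)[OF that] s(2)[OF that] t staircase_mono(2)[OF st that] that
    by (auto simp: g'_def split: if_splits)
  have "s' = t"
    using iff[of t] iff[of s'] t(2) s'(1) by simp
  then show "top_row (P \<union> R) = R"
    unfolding PR unfolding top' R using t(2) by (simp add: g'_def)
  show "P \<inter> R = {}"
    using staircase_mono(2)[OF st, of _ k] by (force simp: P R)
  show "R \<noteq> {}" "card R = w"
    using t by (auto simp: R card_cartesian_product)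
  show "box_width R = w"
    unfolding R_def new_row_def
    using t by (intro box_width_atLeastLessThan) (auto simp: P box_width_columns[OF st])
  have right: "right_column (P \<union> R) = {k} \<times> {f k..<Suc (g k)}"
    unfolding PR right_column_columns[OF st'] using t(2) by (simp add: g'_def)
  \<comment> \<open>The last column contains the new cell \<open>(k, g k)\<close> and the old cell
    \<open>(k, f k)\<close>.\<close>
  have "(k, g k) \<in> right_column (P \<union> R) - P" "(k, f k) \<in> right_column (P \<union> R) - R"
    using staircase_less[OF st, of k] unfolding right by (auto simp: P R)
  then show "\<not> right_column (P \<union> R) \<subseteq> P" "\<not> right_column (P \<union> R) \<subseteq> R"
    by blast+
  show "card (right_column (P \<union> R)) = Suc (card (right_column P))"
    using staircase_less[OF st, of k]
    unfolding right by (auto simp: P right_column_columns[OF st] card_cartesian_product)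
qed

text \<open>The bound on \<open>w\<close> puts the new column beside the old last one, aligned at
  the top, so the staircase conditions survive. The top row gains a cell and then meets both the old
  and the new part; this lets \<open>parent\<close> tell column children from row children.\<close>

lemma add_column:
  assumes "parallelogram_polyomino P" and "1 \<le> w" and "w \<le> card (right_column P)"
  defines "R \<equiv> new_column P w"
  shows "parallelogram_polyomino (P \<union> R)"
    and "poly_size (P \<union> R) = Suc (poly_size P)"
    and "right_column (P \<union> R) = R"
    and "P \<inter> R = {}" and "R \<noteq> {}"
    and "\<not> top_row (P \<union> R) \<subseteq> P" and "\<not> top_row (P \<union> R) \<subseteq> R"
    and "card R = w"
    and "card (top_row (P \<union> R)) = Suc (card (top_row P))"
proof -
  obtain k f g where st: "staircase k f g" and P: "P = columns k f g"
    using staircase_of_polyomino assms(1) by blast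
  define b where "b = g k - w"
  have b: "f k \<le> b" "b < g k" "w = g k - b"
    using assms(2,3) by (auto simp: P right_column_columns[OF st] card_cartesian_product b_def)
  have R: "R = {Suc k} \<times> {b..<g k}"
    by (simp add: R_def new_column_def P box_width_columns[OF st] box_height_columns[OF st] b_def)
  define f' where "f' = f(Suc k := b)"
  define g' where "g' = g(Suc k := g k)"
  have st': "staircase (Suc k) f' g'"
    using st b by (auto simp: staircase_def f'_def g'_def less_Suc_eq)
  have PR: "P \<union> R = columns (Suc k) f' g'"
    by (auto simp: P R columns_def f'_def g'_def le_Suc_eq)
  show "parallelogram_polyomino (P \<union> R)"
    unfolding PR using st' by (rule parallelogram_polyomino_columns)
  show "poly_size (P \<union> R) = Suc (poly_size P)"
    unfolding PR unfolding P poly_size_columns[OF st] poly_size_columns[OF st']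
    by (simp add: g'_def)
  show "right_column (P \<union> R) = R"
    unfolding PR unfolding right_column_columns[OF st'] R by (simp add: f'_def g'_def)
  show "P \<inter> R = {}"
    by (auto simp: P R)
  show "R \<noteq> {}" "card R = w"
    using b by (auto simp: R card_cartesian_product)
  obtain s where s: "s \<le> k" "\<And>i. i \<le> k \<Longrightarrow> g i = g k \<longleftrightarrow> s \<le> i"
    and top: "top_row P = {s..k} \<times> {g k - 1}"
    using top_row_columns[OF st] P by metis
  obtain s' where s': "s' \<le> Suc k" "\<And>i. i \<le> Suc k \<Longrightarrow> g' i = g' (Suc k) \<longleftrightarrow> s' \<le> i"
    and top': "top_row (columns (Suc k) f' g') = {s'..Suc k} \<times> {g' (Suc k) - 1}"
    using top_row_columns[OF st'] by metis
  have iff: "s' \<le> i \<longleftrightarrow> s \<le> i" if "i \<le> k" for i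
    using s'(2)[of i] s(2)[OF that] that by (auto simp: g'_def)
  have "s' \<le> k"
    using s'(2)[of k] by (simp add: g'_def)
  then have "s' = s"
    using iff[of s] iff[of s'] s(1) by simp
  then have top'': "top_row (P \<union> R) = {s..Suc k} \<times> {g k - 1}"
    unfolding PR top' by (simp add: g'_def)
  have "(Suc k, g k - 1) \<in> top_row (P \<union> R) - P" "(k, g k - 1) \<in> top_row (P \<union> R) - R"
    using s(1) unfolding top'' by (auto simp: P R)
  then show "\<not> top_row (P \<union> R) \<subseteq> P" "\<not> top_row (P \<union> R) \<subseteq> R"
    by blast+
  show "card (top_row (P \<union> R)) = Suc (card (top_row P))"
    using s(1) unfolding top'' top by (simp add: card_cartesian_product Suc_diff_le)
qed

text \<open>Deleting the top row strictly lowers the height and cannot widen the box, so a size drop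
  of exactly one forces equal width and a height smaller by one.\<close>

lemma remove_row:
  assumes "parallelogram_polyomino Q" and "parallelogram_polyomino (Q - top_row Q)"
    and "poly_size Q = Suc (poly_size (Q - top_row Q))"
  obtains w where "1 \<le> w" and "w \<le> card (top_row (Q - top_row Q))"
    and "top_row Q = new_row (Q - top_row Q) w"
proof -
  obtain k f g where st: "staircase k f g" and Q: "Q = columns k f g"
    using staircase_of_polyomino assms(1) by blast
  obtain k' f' g' where st': "staircase k' f' g'" and P: "Q - top_row Q = columns k' f' g'"
    using staircase_of_polyomino assms(2) by blast
  obtain s where s: "s \<le> k" "\<And>i. i \<le> k \<Longrightarrow> g i = g k \<longleftrightarrow> s \<le> i"
    and top: "top_row Q = {s..k} \<times> {g k - 1}"
    using top_row_columns[OF st] Q by metis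
  obtain s' where s': "s' \<le> k'" "\<And>i. i \<le> k' \<Longrightarrow> g' i = g' k' \<longleftrightarrow> s' \<le> i"
    and top': "top_row (columns k' f' g') = {s'..k'} \<times> {g' k' - 1}"
    using top_row_columns[OF st'] by metis
  have inP: "(i, j) \<in> columns k' f' g' \<longleftrightarrow> (i, j) \<in> columns k f g \<and> (i, j) \<notin> {s..k} \<times> {g k - 1}"
    for i j
    unfolding P[symmetric] top Q[symmetric] by (rule Diff_iff)
  \<comment> \<open>The highest cell of the last remaining column is a cell of \<open>Q\<close>
    outside its top row; this bounds \<open>k'\<close> and \<open>g' k'\<close>.\<close>
  have "(k', g' k' - 1) \<in> columns k' f' g'"
    using staircase_less[OF st', of k'] by auto
  then have corner: "k' \<le> k" "f k' \<le> g' k' - 1" "g' k' - 1 < g k'" "g' k' - 1 = g k - 1 \<longrightarrow> k' < s"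
    unfolding inP by auto
  have pos: "0 < g' k'"
    using staircase_less[OF st', of k'] by simp
  have "k + g k = Suc (k' + g' k')"
    using assms(3) unfolding P unfolding Q poly_size_columns[OF st] poly_size_columns[OF st'] .
  moreover have "g' k' < g k"
    using corner s(2)[of k'] staircase_mono(2)[OF st, of k' k] pos by linarith
  ultimately have k: "k' = k" and "g k = Suc (g' k')"
    using corner(1) by linarith+
  then have g: "g k = Suc (g' k)"
    by simp
  \<comment> \<open>In column \<open>s\<close> the cell just below the deleted row survives, because
    \<open>f s \<le> f k \<le> g' k - 1\<close>. It lies in the new top row, so the deleted row was
    no wider than that row.\<close>
  have "s' \<le> s"
  proof -
    have "f s \<le> f k" "g s = g k"
      using staircase_mono(1)[OF st, of s k] s by simp_all
    moreover have "f k \<le> g' k - 1"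
      using corner(2) k by simp
    ultimately have "f s \<le> g' k - 1" "g' k - 1 < g s" "g' k - 1 \<noteq> g k - 1"
      using g pos k by simp_all
    then have "(s, g' k - 1) \<in> columns k' f' g'"
      unfolding inP using s(1) by simp
    then have "g' k' \<le> g' s"
      using k pos by auto
    then show ?thesis
      using s'(2)[of s] staircase_mono(2)[OF st', of s k'] s(1) k by simp
  qed
  moreover have "card (top_row (Q - top_row Q)) = Suc k - s'"
    unfolding P top' using k by (simp add: card_cartesian_product)
  moreover have "top_row Q = new_row (Q - top_row Q) (Suc k - s)"
    unfolding P unfolding new_row_def box_width_columns[OF st'] box_height_columns[OF st'] top
    using s(1) by (simp add: k g atLeastLessThanSuc_atLeastAtMost)
  ultimately show thesis
    using s(1) by (intro that[of "Suc k - s"]) auto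
qed

text \<open>Here the width strictly drops and the height cannot grow, so the size drop of one keeps
  the height and removes exactly one column.\<close>

lemma remove_column:
  assumes "parallelogram_polyomino Q" and "parallelogram_polyomino (Q - right_column Q)"
    and "poly_size Q = Suc (poly_size (Q - right_column Q))"
  obtains w where "1 \<le> w" and "w \<le> card (right_column (Q - right_column Q))"
    and "right_column Q = new_column (Q - right_column Q) w"
proof -
  obtain k f g where st: "staircase k f g" and Q: "Q = columns k f g"
    using staircase_of_polyomino assms(1) by blast
  obtain k' f' g' where st': "staircase k' f' g'" and P: "Q - right_column Q = columns k' f' g'"
    using staircase_of_polyomino assms(2) by blast
  have right: "right_column Q = {k} \<times> {f k..<g k}"
    unfolding Q by (rule right_column_columns[OF st])
  have inP: "(i, j) \<in> columns k' f' g' \<longleftrightarrow> (i, j) \<in> columns k f g \<and> (i, j) \<notin> {k} \<times> {f k..<g k}"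
    for i j
    unfolding P[symmetric] right Q[symmetric] by (rule Diff_iff)
  have "(k', g' k' - 1) \<in> columns k' f' g'"
    using staircase_less[OF st', of k'] by auto
  then have "k' \<le> k" "f k' \<le> g' k' - 1" "g' k' - 1 < g k'"
    "\<not> (k' = k \<and> f k \<le> g' k' - 1 \<and> g' k' - 1 < g k)"
    unfolding inP by auto
  then have corner: "k' < k" "g' k' - 1 < g k'"
    by (cases "k' = k"; simp)+
  have "k + g k = Suc (k' + g' k')"
    using assms(3) unfolding P unfolding Q poly_size_columns[OF st] poly_size_columns[OF st'] .
  moreover have "g' k' \<le> g k"
    using corner staircase_mono(2)[OF st, of k' k] by linarith
  ultimately have k: "k = Suc k'" and g: "g k = g' k'"
    using corner(1) by linarith+
  \<comment> \<open>This is the left neighbour of the lowest deleted cell; by the staircase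
    condition it belongs to \<open>Q\<close>.\<close>
  have "(k', f k) \<in> columns k' f' g'"
    unfolding inP using st by (auto simp: staircase_def k)
  then have "f' k' \<le> f k"
    by auto
  moreover have "f k < g k"
    using staircase_less[OF st, of k] by simp
  moreover have "card (right_column (Q - right_column Q)) = g' k' - f' k'"
    unfolding P right_column_columns[OF st'] by (simp add: card_cartesian_product)
  moreover have "right_column Q = new_column (Q - right_column Q) (g k - f k)"
    unfolding P unfolding new_column_def box_width_columns[OF st'] box_height_columns[OF st'] right
    using \<open>f k < g k\<close> by (simp add: k[symmetric] g[symmetric])
  ultimately show thesis
    using g by (intro that[of "g k - f k"]) auto
qed

section \<open>The generating tree of slicings\<close>

text \<open>Since the blocks cover exactly \<open>P\<close>, a set not contained in \<open>P\<close>
  cannot be a block; this is how new blocks are recognised.\<close>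

lemma baxter_slicingD:
  assumes "baxter_slicing n P B Hs"
  shows "parallelogram_polyomino P" and "poly_size P = n" and "\<Union>B = P"
proof -
  have "parallelogram_polyomino P \<and> poly_size P = n \<and> \<Union>B = P"
    using assms by (induction rule: baxter_slicing.induct) (auto simp: top_row_def right_column_def)
  then show "parallelogram_polyomino P" "poly_size P = n" "\<Union>B = P"
    by blast+
qed

lemma poly_size_pos:
  assumes "parallelogram_polyomino P"
  shows "0 < poly_size P"
proof -
  obtain k f g where st: "staircase k f g" and P: "P = columns k f g"
    using staircase_of_polyomino assms by blast
  show ?thesis
    using staircase_less[OF st, of k] by (simp add: P poly_size_columns[OF st])
qed

lemma right_column_top_row_pos:
  assumes "parallelogram_polyomino P"
  shows "0 < card (top_row P)" and "0 < card (right_column P)"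
proof -
  obtain k f g where st: "staircase k f g" and P: "P = columns k f g"
    using staircase_of_polyomino assms by blast
  show "0 < card (top_row P)"
  proof (rule top_row_columns[OF st])
    fix s
    assume "s \<le> k" "top_row (columns k f g) = {s..k} \<times> {g k - 1}"
    then show ?thesis
      by (simp add: P card_cartesian_product)
  qed
  show "0 < card (right_column P)"
    using staircase_less[OF st, of k]
    by (simp add: P right_column_columns[OF st] card_cartesian_product)
qed

type_synonym slicing = "cell set \<times> cell set set"

fun row_child :: "slicing \<Rightarrow> nat \<Rightarrow> slicing" where
  "row_child (P, B) w = (P \<union> new_row P w, insert (new_row P w) B)"

fun column_child :: "slicing \<Rightarrow> nat \<Rightarrow> slicing" where
  "column_child (P, B) w = (P \<union> new_column P w, insert (new_column P w) B)"

definition top_width :: "slicing \<Rightarrow> nat" where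
  "top_width s = card (top_row (fst s))"

definition right_height :: "slicing \<Rightarrow> nat" where
  "right_height s = card (right_column (fst s))"

definition children :: "nat \<Rightarrow> slicing \<Rightarrow> slicing set" where
  "children m s = row_child s ` {1..min m (top_width s)} \<union> column_child s ` {1..right_height s}"

text \<open>A block contained in neither the old polyomino nor the new block cannot occur in a child,
  so exactly one of the top row and the right column of a child is a block.\<close>

fun parent :: "slicing \<Rightarrow> slicing" where
  "parent (Q, C) =
     (if top_row Q \<in> C then (Q - top_row Q, C - {top_row Q})
      else (Q - right_column Q, C - {right_column Q}))"

lemma row_restricted_slicingsD:
  assumes "s \<in> row_restricted_slicings m n"
  shows "parallelogram_polyomino (fst s)" and "\<Union>(snd s) = fst s"
proof -
  obtain Hs where "baxter_slicing n (fst s) (snd s) Hs"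
    using assms by (auto simp: row_restricted_slicings_def)
  then show "parallelogram_polyomino (fst s)" "\<Union>(snd s) = fst s"
    by (fact baxter_slicingD)+
qed

lemma label_pos:
  assumes "s \<in> row_restricted_slicings m n"
  shows "1 \<le> top_width s" and "1 \<le> right_height s"
  using right_column_top_row_pos[OF row_restricted_slicingsD(1)[OF assms]]
  by (simp_all add: top_width_def right_height_def)

text \<open>A left inverse makes the child sets of different slicings disjoint. A new block is
  nonempty and disjoint from \<open>P\<close>, hence not in \<open>B\<close>, so removing it from
  the child restores \<open>B\<close> exactly.\<close>

lemma parent_child:
  assumes "s \<in> row_restricted_slicings m n" and "c \<in> children m s"
  shows "parent c = s"
proof -
  obtain P B where s: "s = (P, B)"
    by fastforce
  have P: "parallelogram_polyomino P" "\<Union>B = P"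
    using row_restricted_slicingsD[OF assms(1)] by (auto simp: s)
  consider w where "1 \<le> w" "w \<le> card (top_row P)" "c = row_child s w"
    | w where "1 \<le> w" "w \<le> card (right_column P)" "c = column_child s w"
    using assms(2) by (auto simp: children_def top_width_def right_height_def s)
  then show ?thesis
  proof cases
    case (1 w)
    note R = add_row[OF P(1) 1(1,2)]
    have "new_row P w \<notin> B"
      using R(4,5) P(2) by blast
    then show ?thesis
      using R(4) by (auto simp: 1 s R(3))
  next
    case (2 w)
    note R = add_column[OF P(1) 2(1,2)]
    have "new_column P w \<notin> B"
      using R(4,5) P(2) by blast
    moreover have "top_row (P \<union> new_column P w) \<notin> insert (new_column P w) B"
      using R(6,7) P(2) by blast
    ultimately show ?thesis
      using R(4) by (auto simp: 2 s R(3))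
  qed
qed

lemma label_row_child:
  assumes "s \<in> row_restricted_slicings m n" and "1 \<le> w" and "w \<le> top_width s"
  shows "top_width (row_child s w) = w" and "right_height (row_child s w) = Suc (right_height s)"
  using add_row(3,8,10)[OF row_restricted_slicingsD(1)[OF assms(1)] assms(2)] assms(3)
  by (cases s; simp add: top_width_def right_height_def)+

lemma label_column_child:
  assumes "s \<in> row_restricted_slicings m n" and "1 \<le> w" and "w \<le> right_height s"
  shows "top_width (column_child s w) = Suc (top_width s)" and "right_height (column_child s w) = w"
  using add_column(3,8,9)[OF row_restricted_slicingsD(1)[OF assms(1)] assms(2)] assms(3)
  by (cases s; simp add: top_width_def right_height_def)+

lemma finite_children: "finite (children m s)"
  by (simp add: children_def)

text \<open>The labels separate the children: row children differ in \<open>top_width\<close>,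
  column children in \<open>right_height\<close>, and only row children exceed the
  \<open>right_height\<close> of \<open>s\<close>.\<close>

lemma sum_children:
  fixes F :: "nat \<Rightarrow> nat \<Rightarrow> 'a::comm_monoid_add"
  assumes "s \<in> row_restricted_slicings m n"
  shows "(\<Sum>c\<in>children m s. F (top_width c) (right_height c)) =
    (\<Sum>w = 1..min m (top_width s). F w (Suc (right_height s))) +
    (\<Sum>w = 1..right_height s. F (Suc (top_width s)) w)"
proof -
  note labels = label_row_child[OF assms] label_column_child[OF assms]
  have "inj_on (row_child s) {1..min m (top_width s)}"
    by (rule inj_on_inverseI[of _ top_width]) (simp add: labels)
  moreover have "inj_on (column_child s) {1..right_height s}"
    by (rule inj_on_inverseI[of _ right_height]) (simp add: labels)
  moreover have "row_child s ` {1..min m (top_width s)} \<inter> column_child s ` {1..right_height s} = {}"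
  proof -
    have "row_child s v \<noteq> column_child s w"
      if "v \<in> {1..min m (top_width s)}" "w \<in> {1..right_height s}" for v w
    proof
      assume "row_child s v = column_child s w"
      then have "right_height (row_child s v) = right_height (column_child s w)"
        by simp
      then show False
        using that by (simp add: labels)
    qed
    then show ?thesis
      by blast
  qed
  ultimately show ?thesis
    unfolding children_def
    by (subst sum.union_disjoint)
      (auto simp: sum.reindex labels intro!: arg_cong2[of _ _ _ _ "(+)"] sum.cong)
qed

lemma row_restricted_slicings_1:
  "row_restricted_slicings m 1 = {({(0, 0)}, {{(0, 0)}})}"
proof -
  have st: "staircase 0 (\<lambda>_. 0) (\<lambda>_. 1)" and cell: "{(0, 0)} = columns 0 (\<lambda>_. 0) (\<lambda>_. 1)"
    by (auto simp: staircase_def columns_def)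
  have "baxter_slicing 1 {(0, 0)} {{(0, 0)}} {}"
    unfolding cell using parallelogram_polyomino_columns[OF st] poly_size_columns[OF st]
    by (intro baxter_slicing.single) auto
  moreover have "P = {(0, 0)} \<and> B = {{(0, 0)}}" if "baxter_slicing 1 P B Hs" for P B Hs
    using that
  proof cases
    case single
    obtain k f g where st': "staircase k f g" and P: "P = columns k f g"
      using staircase_of_polyomino single by blast
    have "k + g k = 1"
      using single by (simp add: P poly_size_columns[OF st'])
    moreover have "f k < g k" "f 0 = 0"
      using st' by (auto simp: staircase_def)
    ultimately have "k = 0" "g 0 = 1" "f 0 = 0"
      by (cases k; simp)+
    then have "P = {(0, 0)}"
      by (auto simp: P columns_def)
    then show ?thesis
      using single by simp
  next
    \<comment> \<open>Deleting a block would leave a polyomino of size \<open>0\<close>, but sizes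
      are positive; the vertical case is the same.\<close>
    case (horizontal n B' Hs')
    then show ?thesis
      using poly_size_pos[OF baxter_slicingD(1)[OF horizontal(6)]]
        baxter_slicingD(2)[OF horizontal(6)] by simp
  next
    case (vertical n B')
    then show ?thesis
      using poly_size_pos[OF baxter_slicingD(1)[OF vertical(5)]]
        baxter_slicingD(2)[OF vertical(5)] by simp
  qed
  ultimately show ?thesis
    by (fastforce simp: row_restricted_slicings_def)
qed

text \<open>One inclusion peels off the last block by \<open>remove_row\<close> or
  \<open>remove_column\<close>, the other uses \<open>add_row\<close> and \<open>add_column\<close>.
  The restriction on \<open>Hs\<close> becomes \<open>w \<le> m\<close> because the new row has
  \<open>box_width\<close> equal to \<open>w\<close>; \<open>1 \<le> n\<close> excludes the rule
  \<open>single\<close>.\<close>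

lemma row_restricted_slicings_Suc:
  assumes "1 \<le> n"
  shows "row_restricted_slicings m (Suc n) = (\<Union>s\<in>row_restricted_slicings m n. children m s)"
proof (intro equalityI subsetI)
  fix c
  assume "c \<in> row_restricted_slicings m (Suc n)"
  then obtain Q C Hs where c: "c = (Q, C)" and bax: "baxter_slicing (Suc n) Q C Hs"
    and width: "\<forall>b\<in>Hs. box_width b \<le> m"
    by (auto simp: row_restricted_slicings_def)
  from bax show "c \<in> (\<Union>s\<in>row_restricted_slicings m n. children m s)"
  proof cases
    case single
    then show ?thesis
      using assms by simp
  next
    case (horizontal B Hs')
    note P = baxter_slicingD[OF horizontal(5)]
    obtain w where w: "1 \<le> w" "w \<le> card (top_row (Q - top_row Q))"
      "top_row Q = new_row (Q - top_row Q) w"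
      using remove_row horizontal(3,4) P by metis
    have "w \<le> m"
      using width horizontal(2) add_row(9)[OF P(1) w(1,2)] w(3) by auto
    moreover have "(Q - top_row Q, B) \<in> row_restricted_slicings m n"
      using horizontal(2,5) width by (auto simp: row_restricted_slicings_def)
    moreover have "c = row_child (Q - top_row Q, B) w"
      using horizontal(1) unfolding c row_child.simps w(3)[symmetric] by (auto simp: top_row_def)
    moreover have "w \<in> {1..min m (top_width (Q - top_row Q, B))}"
      using w(1,2) \<open>w \<le> m\<close> by (simp add: top_width_def)
    ultimately show ?thesis
      unfolding children_def by blast
  next
    case (vertical B)
    note P = baxter_slicingD[OF vertical(4)]
    obtain w where w: "1 \<le> w" "w \<le> card (right_column (Q - right_column Q))"
      "right_column Q = new_column (Q - right_column Q) w"
      using remove_column vertical(2,3) P by metis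
    have "(Q - right_column Q, B) \<in> row_restricted_slicings m n"
      using vertical(4) width by (auto simp: row_restricted_slicings_def)
    moreover have "c = column_child (Q - right_column Q, B) w"
      using vertical(1) unfolding c column_child.simps w(3)[symmetric]
      by (auto simp: right_column_def)
    moreover have "w \<in> {1..right_height (Q - right_column Q, B)}"
      using w(1,2) by (simp add: right_height_def)
    ultimately show ?thesis
      unfolding children_def by blast
  qed
next
  fix c
  assume "c \<in> (\<Union>s\<in>row_restricted_slicings m n. children m s)"
  then obtain P B Hs where bax: "baxter_slicing n P B Hs"
    and width: "\<forall>b\<in>Hs. box_width b \<le> m" and c: "c \<in> children m (P, B)"
    by (auto simp: row_restricted_slicings_def)
  note P = baxter_slicingD[OF bax]
  consider w where "1 \<le> w" "w \<le> card (top_row P)" "w \<le> m" "c = row_child (P, B) w"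
    | w where "1 \<le> w" "w \<le> card (right_column P)" "c = column_child (P, B) w"
    using c by (auto simp: children_def top_width_def right_height_def)
  then show "c \<in> row_restricted_slicings m (Suc n)"
  proof cases
    case (1 w)
    note R = add_row[OF P(1) 1(1,2)]
    have "P \<union> new_row P w - new_row P w = P"
      using R(4) by blast
    then have "baxter_slicing (Suc n) (P \<union> new_row P w)
        (insert (new_row P w) B) (insert (new_row P w) Hs)"
      using baxter_slicing.horizontal[OF R(1), of n B Hs] R(2,3) P(2) bax by simp
    then show ?thesis
      using width R(9) 1(3) by (auto simp: 1(4) row_restricted_slicings_def)
  next
    case (2 w)
    note R = add_column[OF P(1) 2(1,2)]
    have "P \<union> new_column P w - new_column P w = P"
      using R(4) by blast
    then have "baxter_slicing (Suc n) (P \<union> new_column P w) (insert (new_column P w) B) Hs"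
      using baxter_slicing.vertical[OF R(1), of n B Hs] R(2,3) P(2) bax by simp
    then show ?thesis
      using width by (auto simp: 2(3) row_restricted_slicings_def)
  qed
qed

lemma finite_row_restricted_slicings:
  assumes "1 \<le> n"
  shows "finite (row_restricted_slicings m n)"
  using assms
proof (induction rule: dec_induct)
  case base
  show ?case
    unfolding row_restricted_slicings_1 by simp
next
  case (step n)
  then show ?case
    unfolding row_restricted_slicings_Suc[OF step(1)] by (simp add: finite_children)
qed

text \<open>Any weight depending only on the label can be moved one level up the tree.
  \<open>F\<close> is arbitrary so that it can later be a coefficient of a power series.\<close>

lemma sum_row_restricted_slicings_Suc:
  fixes F :: "nat \<Rightarrow> nat \<Rightarrow> 'a::comm_monoid_add"
  assumes "1 \<le> n"
  shows "(\<Sum>c\<in>row_restricted_slicings m (Suc n). F (top_width c) (right_height c)) =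
    (\<Sum>s\<in>row_restricted_slicings m n.
      (\<Sum>w = 1..min m (top_width s). F w (Suc (right_height s))) +
      (\<Sum>w = 1..right_height s. F (Suc (top_width s)) w))"
proof -
  have "children m s \<inter> children m s' = {}"
    if "s \<in> row_restricted_slicings m n" "s' \<in> row_restricted_slicings m n" "s \<noteq> s'" for s s'
    using parent_child[OF that(1)] parent_child[OF that(2)] that(3) by (metis disjoint_iff)
  then have "(\<Sum>c\<in>row_restricted_slicings m (Suc n). F (top_width c) (right_height c)) =
      (\<Sum>s\<in>row_restricted_slicings m n. \<Sum>c\<in>children m s. F (top_width c) (right_height c))"
    unfolding row_restricted_slicings_Suc[OF assms]
    using finite_row_restricted_slicings[OF assms] finite_children
    by (intro sum.UNION_disjoint) auto
  then show ?thesis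
    by (simp add: sum_children)
qed

section \<open>Solving the recurrence\<close>

unbundle fps_syntax

text \<open>The equation reads H = x D(H), so H is the compositional inverse of x / D(x), which
  exists because \<open>D\<close> has constant term 1.\<close>

lemma ex_fps_solution:
  "\<exists>H :: 'a::field fps. H $ 0 = 0 \<and> H = fps_X * (1 + H) * (1 + H + H\<^sup>2)"
proof -
  define D :: "'a fps" where "D = (1 + fps_X) * (1 + fps_X + fps_X\<^sup>2)"
  define G where "G = fps_X * inverse D"
  define H where "H = fps_inv G"
  have D0: "D $ 0 = 1"
    by (simp add: D_def)
  have H0: "H $ 0 = 0"
    by (simp add: H_def fps_inv_def)
  have "G oo H = fps_X"
    unfolding H_def by (rule fps_inv_right) (simp_all add: G_def D0)
  then have "H * inverse (D oo H) = fps_X"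
    using H0 D0 by (simp add: G_def fps_compose_mult_distrib fps_inverse_compose)
  moreover have DH: "D oo H = (1 + H) * (1 + H + H\<^sup>2)"
    using H0 by (simp add: D_def fps_compose_mult_distrib fps_compose_add_distrib power2_eq_square)
  moreover have "inverse (D oo H) * (D oo H) = 1"
    by (rule inverse_mult_eq_1) (simp add: D0)
  ultimately have "H = fps_X * (D oo H)"
    by (metis mult.assoc mult.right_neutral)
  then show ?thesis
    using H0 by (auto simp: DH mult.assoc)
qed

text \<open>Nodes are weighted by depth, the root of the subtree counting as x. All \<open>h\<close>
  from 2 on share one series, because rows depend only on \<open>min 2 h\<close> and new columns
  always lead to a first label of at least 2.\<close>

definition subtree_gf :: "rat fps \<Rightarrow> nat \<Rightarrow> nat \<Rightarrow> rat fps" where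
  "subtree_gf H h k = (if h \<le> 1 then H else H * (1 + H)) * (1 + H + H\<^sup>2) ^ (k - 1)"

lemma sum_subtree_gf_columns:
  assumes "1 \<le> h"
  shows "(\<Sum>j = 1..k. subtree_gf H (Suc h) j) = (1 + H + H\<^sup>2) ^ k - 1"
  using assms by (induction k) (auto simp: subtree_gf_def algebra_simps power2_eq_square)

text \<open>With r = 1 + H + H^2, the bracket equals (1 + H) r^k for h = 1 and (1 + H)^2 r^k for
  larger h; a factor x (1 + H) r then turns into H.\<close>

lemma subtree_gf_rec:
  fixes H :: "rat fps"
  assumes H: "H = fps_X * (1 + H) * (1 + H + H\<^sup>2)" and "1 \<le> h" and "1 \<le> k"
  shows "subtree_gf H h k = fps_X * (1 +
    ((\<Sum>w = 1..min 2 h. subtree_gf H w (Suc k)) + (\<Sum>j = 1..k. subtree_gf H (Suc h) j)))"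
proof -
  define r where "r = 1 + H + H\<^sup>2"
  have r: "r ^ k = r * r ^ (k - 1)"
    using assms(3) by (cases k) auto
  have Hr: "H = fps_X * (1 + H) * r"
    using H by (simp add: r_def)
  consider "h = 1" | "2 \<le> h"
    using assms(2) by linarith
  then show ?thesis
  proof cases
    case 1
    have "H * r ^ (k - 1) = fps_X * (1 + H) * r * r ^ (k - 1)"
      using Hr by simp
    then show ?thesis
      unfolding sum_subtree_gf_columns[OF assms(2)]
      unfolding subtree_gf_def r_def[symmetric] using 1 r by (simp add: algebra_simps)
  next
    case 2
    then have "{1..min 2 h} = {1, 2}"
      by auto
    then have rows: "(\<Sum>w = 1..min 2 h. subtree_gf H w (Suc k)) = H * r ^ k + H * (1 + H) * r ^ k"
      by (simp add: subtree_gf_def r_def)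
    have "subtree_gf H h k = fps_X * (1 + H) * r * (1 + H) * r ^ (k - 1)"
      using 2 Hr by (simp add: subtree_gf_def r_def)
    also have "\<dots> = fps_X * (1 + (H * r ^ k + H * (1 + H) * r ^ k + (r ^ k - 1)))"
      unfolding r by (simp add: algebra_simps)
    finally show ?thesis
      unfolding rows sum_subtree_gf_columns[OF assms(2)] r_def .
  qed
qed

text \<open>By the recurrence, coefficient \<open>Suc (Suc m)\<close> at a node is the sum of the
  coefficients \<open>Suc m\<close> over its children. Going down a level thus raises
  \<open>n\<close> and lowers \<open>m\<close>, keeping \<open>n + m\<close> fixed, down from the
  root series \<open>H\<close>.\<close>

lemma sum_subtree_gf:
  fixes H :: "rat fps"
  assumes H: "H = fps_X * (1 + H) * (1 + H + H\<^sup>2)" and "1 \<le> n"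
  shows "(\<Sum>s\<in>row_restricted_slicings 2 n. subtree_gf H (top_width s) (right_height s) $ Suc m) =
    H $ (n + m)"
  using assms(2)
proof (induction arbitrary: m rule: dec_induct)
  case base
  have "top_row {(0, 0)} = {(0, 0)}" "right_column {(0, 0)} = {(0, 0)}"
    by (auto simp: top_row_def right_column_def)
  then show ?case
    unfolding row_restricted_slicings_1
    by (simp add: subtree_gf_def top_width_def right_height_def)
next
  case (step n)
  have "(\<Sum>s\<in>row_restricted_slicings 2 (Suc n).
      subtree_gf H (top_width s) (right_height s) $ Suc m) =
    (\<Sum>s\<in>row_restricted_slicings 2 n.
      subtree_gf H (top_width s) (right_height s) $ Suc (Suc m))"
    unfolding sum_row_restricted_slicings_Suc
      [OF step(1), where F = "\<lambda>h k. subtree_gf H h k $ Suc m"]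
  proof (intro sum.cong refl)
    fix s
    assume "s \<in> row_restricted_slicings 2 n"
    \<comment> \<open>The factor \<open>fps_X\<close> shifts the index to \<open>Suc m\<close>,
      where the summand \<open>1\<close> has coefficient zero.\<close>
    from subtree_gf_rec[OF H label_pos[OF this]]
    show "(\<Sum>w = 1..min 2 (top_width s). subtree_gf H w (Suc (right_height s)) $ Suc m) +
        (\<Sum>w = 1..right_height s. subtree_gf H (Suc (top_width s)) w $ Suc m) =
      subtree_gf H (top_width s) (right_height s) $ Suc (Suc m)"
      by (simp add: fps_sum_nth)
  qed
  then show ?case
    using step(3)[of "Suc m"] by simp
qed

text \<open>Constant terms vanish, so coefficient 1 of every subtree series is 1, the node itself;
  the level sum with \<open>m = 0\<close> therefore counts nodes.\<close>

lemma card_row_restricted_slicings: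
  fixes H :: "rat fps"
  assumes "H $ 0 = 0" and H: "H = fps_X * (1 + H) * (1 + H + H\<^sup>2)" and "1 \<le> n"
  shows "of_nat (card (row_restricted_slicings 2 n)) = H $ n"
proof -
  have zero: "subtree_gf H h k $ 0 = 0" for h k
    using assms(1) by (simp add: subtree_gf_def)
  have "subtree_gf H (top_width s) (right_height s) $ 1 = 1"
    if "s \<in> row_restricted_slicings 2 n" for s
    by (subst subtree_gf_rec[OF H]) (use label_pos[OF that] in \<open>auto simp: fps_sum_nth zero\<close>)
  then show ?thesis
    using sum_subtree_gf[OF H assms(3), of 0] by simp
qed

theorem theorem13:
  "slicing_gf = fps_X * (slicing_gf + 1) / (1 - fps_X * (slicing_gf + 1)^2)"
proof -
  obtain H :: "rat fps" where H0: "H $ 0 = 0" and H: "H = fps_X * (1 + H) * (1 + H + H\<^sup>2)"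
    using ex_fps_solution by blast
  \<comment> \<open>\<open>H $ 0 = 0\<close> matches the value of \<open>slicing_gf\<close> at index
    \<open>0\<close>.\<close>
  have gf: "slicing_gf = H"
    using H0 card_row_restricted_slicings[OF H0 H] by (auto simp: slicing_gf_def fps_eq_iff Suc_le_eq)
  define D where "D = 1 - fps_X * (H + 1)\<^sup>2"
  have "D $ 0 = 1"
    by (simp add: D_def)
  then have "D \<noteq> 0"
    by auto
  moreover have "H * D = fps_X * (H + 1)"
  proof -
    \<comment> \<open>Since (1 + H + H^2) - 1 = H (1 + H), the last two terms combine to -x H (1 +
      H)^2.\<close>
    have "H * D = H - fps_X * (1 + H) * (1 + H + H\<^sup>2) + fps_X * (H + 1)"
      by (simp add: D_def algebra_simps power2_eq_square)
    then show ?thesis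
      using H by simp
  qed
  ultimately have "H = fps_X * (H + 1) / D"
    by (metis nonzero_mult_div_cancel_right)
  then show ?thesis
    by (simp add: gf D_def)
qed

end
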